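(* Consider an instance of the ADS-PB algorithm (described in the context) applied to $\min_{x\in\Omega} f(x)$ and run for infinitely many iterations. Assume that all the points at which the objective and constraint functions are evaluated belong to a compact set $L\subset\mathbb{R}^n$. If $\{p^k_{\rm F}\}_{k\in\mathcal{K}}$ is a refining subsequence of feasible poll centers converging to $\hat x_{\rm F}\in\Omega$, near which $f$ is Lipschitz continuous, then for all refining directions $\hat v\in T^{\rm H}_\Omega(\hat x_{\rm F})$ for $\hat x_{\rm F}$, $$f^\circ(\hat x_{\rm F};\hat v)\ \ge\ 0 .$$
   Context: **Problem.** $X\subseteq\mathbb{R}^n$, $f:X\to\overline{\mathbb{R}}$, $c_j:X\to\overline{\mathbb{R}}$ for $j$ in a finite index set $J$, and $\Omega=\{x\in X: c_j(x)\le 0\ \forall j\in J\}$. The constraint violation function $h:\mathbb{R}^n\to\overline{\mathbb{R}}^+$ is $h(x)=\sum_{j\in J}\max(0,c_j(x))^2$ if $x\in X$ and $h(x)=+\infty$ otherwise; thus $\Omega=\{x\in X:h(x)=0\}$. Points of $\Omega$ are called feasible, points of $X\setminus\Omega$ infeasible. $\|\cdot\|$ is the Euclidean norm, $B_\epsilon(z)$ the ball of radius $\epsilon$ around $z$. **Dominance.** For $x,y\in\Omega$: $x\prec y$ if $f(x)<f(y)$. For $x,y\in X\setminus\Omega$: $x\prec y$ if either $f(x)<f(y)$ and $h(x)\le h(y)$, or $f(x)\le f(y)$ and $h(x)<h(y)$. **Data at iteration $k$.** The cache $\mathcal{C}^k$ is the finite set of points at which the functions have been evaluated before iteration $k$;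 $\mathbb{V}^k_{\rm succ}\subseteq\mathcal{C}^k$ is the set of stored successful points; $\delta^k>0$ is the exclusion size parameter; $\Delta^k>0$ is the frame size parameter; $h^k_{\max}\in[0,+\infty]$ is the barrier threshold. The punctured space is $$P_k:=\{x\in\mathbb{R}^n:\ \|x-y\|\ge\delta^k\ \text{for all } y\in\mathbb{V}^k_{\rm succ}\}.$$ Let $F^k=\operatorname{argmin}_{x\in\mathcal{C}^k}\{f(x):h(x)=0\}$, let $U^k$ be the set of $x\in\mathcal{C}^k\setminus\Omega$ for which no $y\in\mathcal{C}^k\setminus\Omega$ satisfies $y\prec x$, and let $I^k=\operatorname{argmin}_{x\in U^k}\{f(x):0<h(x)\le h^k_{\max}\}$. When nonempty, an incumbent $x^k_{\rm F}\in F^k$, respectively $x^k_{\rm I}\in I^k$, is chosen arbitrarily; $h^k_{\rm I}:=h(x^k_{\rm I})$. **Dominating points.** A feasible trial point $t$ is dominating if $F^k=\emptyset$ or $t\prec x^k_{\rm F}$. An infeasible trial point $t$ is dominating if $I^k=\emptyset$ (first infeasible point found) or $t\prec x^k_{\rm I}$. In the poll step, the references $x^k_{\rm F},x^k_{\rm I}$ are replaced by the poll centers $p^k_{\rm F},p^k_{\rm I}$ defined below. An improving point is a non-dominating point $t$ with $0<h(t)<h^k_{\rm I}$. **ADS-PB algorithm.** *Initialization.* $x^0\in X$, $0<\delta^0\le\Delta^0$, $h^0_{\max}=+\infty$, $\mathcal{C}^0=\mathbb{V}^0_{\rm succ}=\{x^0\}$. *Iteration $k$.* 1. *Search.* A finite,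 possibly empty, set $\mathbb{S}^k\subset X$ is chosen arbitrarily and its points are evaluated; evaluation may be interrupted as soon as a dominating point is found. $\mathbb{S}^k_{\rm eval}$ is the set of points evaluated. If a dominating $t_{\rm search}\in\mathbb{S}^k_{\rm eval}$ with $t_{\rm search}\in P_k$ is found, set $T^k_{\rm succ}=\{t_{\rm search}\}$ and skip the poll. If a dominating $t_{\rm search}\notin P_k$ is found, the search is interrupted and the poll is performed. 2. *Poll.* The feasible poll center $p^k_{\rm F}$ is $t_{\rm search}$ if $t_{\rm search}\in\Omega$ is dominating, and $x^k_{\rm F}$ otherwise (if defined). The infeasible poll center $p^k_{\rm I}$ is $t_{\rm search}$ if $t_{\rm search}\notin\Omega$ is dominating, and $x^k_{\rm I}$ otherwise (if defined). $\mathbb{D}^k_{\rm F},\mathbb{D}^k_{\rm I}$ are finite sets of unit vectors (poll directions), each a positive spanning set of $\mathbb{R}^n$. The poll set $\mathbb{P}^k$ is $\{p^k_{\rm F}+\Delta^k v:v\in\mathbb{D}^k_{\rm F}\}$ if $I^k=\emptyset$, $\{p^k_{\rm I}+\Delta^k v:v\in\mathbb{D}^k_{\rm I}\}$ if $F^k=\emptyset$, and the union of both otherwise. Poll points outside $P_k$ are discarded without evaluation; the others are evaluated, possibly stopping as soon as a dominating one is found. $\mathbb{P}^k_{\rm eval}$ is the set of evaluated poll points. If a dominating $t_{\rm poll}\in\mathbb{P}^k_{\rm eval}\cap P_k$ is found, set $T^k_{\rm succ}=\{t_{\rm poll}\}$. 3. *Update.* $\mathcal{C}^{k+1}=\mathcal{C}^k\cup\mathbb{S}^k_{\rm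 eval}\cup\mathbb{P}^k_{\rm eval}$. Iteration $k$ is declared: *dominating* if $T^k_{\rm succ}\ne\emptyset$; else *reframing* if the search produced a dominating point (necessarily outside $P_k$); else *improving* if there is an improving point $t_{\rm update}\in\mathcal{C}^{k+1}\cap P_k$, in which case $T^k_{\rm succ}=\{t_{\rm update}\}$; else *unsuccessful*. If not set above, $T^k_{\rm succ}=\emptyset$. Set $\mathbb{V}^{k+1}_{\rm succ}=\mathbb{V}^k_{\rm succ}\cup T^k_{\rm succ}$. Set $h^{k+1}_{\max}=\max\{h(x):x\in\mathcal{C}^{k+1},\,0<h(x)<h^k_{\max}\}$ if the iteration is improving, and $h^{k+1}_{\max}=h^{k+1}_{\rm I}$ otherwise, where $h^{k+1}_{\rm I}$ is the $h$-value of an element of $\operatorname{argmin}_{x\in U^{k+1}}\{f(x):0<h(x)\le h^k_{\max}\}$ (threshold unchanged if there is none). Finally $(\Delta^{k+1},\delta^{k+1})$ equals $\mathtt{increase}(\Delta^k,\delta^k)$ if the iteration is dominating, $(\Delta^k,\delta^k)$ if improving, and $\mathtt{decrease}(\Delta^k,\delta^k)$ if reframing or unsuccessful. **Properties of the update rules.** The rules keep both parameters positive and are such that, along any run: (i) an application of $\mathtt{decrease}$ gives $\delta^{k+1}\le\delta^k$, and if all but finitely many iterations apply $\mathtt{decrease}$ then $\delta^k\to0$; (ii) for every $\varepsilon>0$ there is $\eta>0$ such that whenever iteration $k$ applies $\mathtt{increase}$ and $\delta^k<\eta$, then $\delta^{k+1}<\varepsilon$; (iii) if $\lim_k\delta^k=0$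 then $\lim_k\delta^k/\Delta^k=0$ and $\lim_k\Delta^k=0$. **Refining subsequence and direction.** A convergent subsequence $\{p^k_{\rm F}\}_{k\in\mathcal{K}}$ of feasible poll centers, where $\mathcal{K}$ is an infinite set of indices of unsuccessful iterations, is a refining subsequence if $\lim_{k\in\mathcal{K}}\Delta^k=0$; its limit $\hat x_{\rm F}$ is called a refined point. If $\hat v=\lim_{k\in\mathcal{L}}v^k$ exists for some infinite $\mathcal{L}\subseteq\mathcal{K}$ with poll directions $v^k\in\mathbb{D}^k_{\rm F}$, and if $p^k_{\rm F}+\Delta^kv^k\in X$ for infinitely many $k\in\mathcal{L}$, then $\hat v$ is a refining direction for $\hat x_{\rm F}$. **Hypertangent cone.** $\hat v\in\mathbb{R}^n$ is hypertangent to $\Omega$ at $\hat x\in\Omega$ if there is $\epsilon>0$ such that $p+tv\in\Omega$ for all $p\in\Omega\cap B_\epsilon(\hat x)$, $v\in B_\epsilon(\hat v)$ and $0<t<\epsilon$. $T^{\rm H}_\Omega(\hat x)$ is the set of all such $\hat v$. **Clarke–Jahn derivative.** For $\hat x\in\Omega$, $\hat v\in T^{\rm H}_\Omega(\hat x)$ and $f$ Lipschitz continuous near $\hat x$ (finite and Lipschitz on the part of its domain $X$ lying in a neighborhood of $\hat x$), $$f^\circ(\hat x;\hat v):=\limsup_{\substack{p\to\hat x,\ t\searrow0\\ p\in\Omega,\ p+t\hat v\in\Omega}}\frac{f(p+t\hat v)-f(p)}{t}.$$ *)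

theory Defs
  imports "HOL-Analysis.Analysis"
begin

section \<open>Constrained problem and dominance\<close>

text \<open>The objective and the constraints are functions on the ground set \<open>X\<close>. As HOL functions are
  total, their values outside \<open>X\<close> are meaningless, and no definition below depends on them.\<close>

record ('a, 'j) problem =
  ground :: "'a set"
  objective :: "'a \<Rightarrow> ereal"
  constr :: "'j \<Rightarrow> 'a \<Rightarrow> ereal"
  indices :: "'j set"

definition feasible :: "('a, 'j) problem \<Rightarrow> 'a set" where
  "feasible P = {x \<in> ground P. \<forall>j\<in>indices P. constr P j x \<le> 0}"

definition infeasible :: "('a, 'j) problem \<Rightarrow> 'a set" where
  "infeasible P = ground P - feasible P"

definition viol :: "('a, 'j) problem \<Rightarrow> 'a \<Rightarrow> ereal" where
  "viol P x = (if x \<in> ground P then (\<Sum>j\<in>indices P. (max 0 (constr P j x))\<^sup>2) else \<infinity>)"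

lemma feasible_iff_viol_eq_0:
  assumes "finite (indices P)"
  shows "feasible P = {x \<in> ground P. viol P x = 0}"
proof -
  have "(max 0 a)\<^sup>2 = 0 \<longleftrightarrow> a \<le> 0" for a :: ereal
    by (auto simp: power2_eq_square max_def)
  then show ?thesis
    using assms by (auto simp: feasible_def viol_def sum_nonneg_eq_0_iff power2_eq_square)
qed

definition dominates :: "('a, 'j) problem \<Rightarrow> 'a \<Rightarrow> 'a \<Rightarrow> bool" where
  "dominates P x y \<longleftrightarrow>
     x \<in> feasible P \<and> y \<in> feasible P \<and> objective P x < objective P y
   \<or> x \<in> infeasible P \<and> y \<in> infeasible P \<and>
       (objective P x < objective P y \<and> viol P x \<le> viol P y
      \<or> objective P x \<le> objective P y \<and> viol P x < viol P y)"

text \<open>The sets \<open>F\<close>, \<open>U\<close> and \<open>I\<close> belonging to a cache \<open>C\<close> and a threshold \<open>\<eta>\<close>. Points of \<open>C\<close> outside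
  the ground set are ignored in \<open>U\<close> and \<open>I\<close>, as the objective is not defined there.\<close>

definition best_feasible :: "('a, 'j) problem \<Rightarrow> 'a set \<Rightarrow> 'a set" where
  "best_feasible P C = {x. is_arg_min (objective P) (\<lambda>x. x \<in> C \<and> viol P x = 0) x}"

definition undominated :: "('a, 'j) problem \<Rightarrow> 'a set \<Rightarrow> 'a set" where
  "undominated P C =
     {x \<in> C \<inter> infeasible P. \<not> (\<exists>y\<in>C \<inter> infeasible P. dominates P y x)}"

definition best_infeasible :: "('a, 'j) problem \<Rightarrow> 'a set \<Rightarrow> ereal \<Rightarrow> 'a set" where
  "best_infeasible P C \<eta> =
     {x. is_arg_min (objective P) (\<lambda>x. x \<in> undominated P C \<and> 0 < viol P x \<and> viol P x \<le> \<eta>) x}"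


section \<open>Runs of ADS-PB\<close>

datatype outcome = Dominating | Reframing | Improving | Unsuccessful

text \<open>All data of an infinite run, indexed by the iteration number. The incumbents \<open>incF\<close> and \<open>incI\<close>
  are meaningful only when \<open>setF\<close> and \<open>setI\<close> below are nonempty; \<open>t_search\<close> is \<open>None\<close> if the search
  found no dominating point.\<close>

record 'a ads_run =
  cache :: "nat \<Rightarrow> 'a set"
  succ_pts :: "nat \<Rightarrow> 'a set"
  excl :: "nat \<Rightarrow> real"
  frame :: "nat \<Rightarrow> real"
  hmax :: "nat \<Rightarrow> ereal"
  incF :: "nat \<Rightarrow> 'a"
  incI :: "nat \<Rightarrow> 'a"
  search_set :: "nat \<Rightarrow> 'a set"
  search_eval :: "nat \<Rightarrow> 'a set"
  t_search :: "nat \<Rightarrow> 'a option"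
  dirsF :: "nat \<Rightarrow> 'a set"
  dirsI :: "nat \<Rightarrow> 'a set"
  poll_eval :: "nat \<Rightarrow> 'a set"
  new_succ :: "nat \<Rightarrow> 'a set"
  outcome_of :: "nat \<Rightarrow> outcome"

definition punctured :: "'a::real_normed_vector ads_run \<Rightarrow> nat \<Rightarrow> 'a set" where
  "punctured R k = {x. \<forall>y\<in>succ_pts R k. norm (x - y) \<ge> excl R k}"

definition setF :: "('a, 'j) problem \<Rightarrow> 'a ads_run \<Rightarrow> nat \<Rightarrow> 'a set" where
  "setF P R k = best_feasible P (cache R k)"

definition setI :: "('a, 'j) problem \<Rightarrow> 'a ads_run \<Rightarrow> nat \<Rightarrow> 'a set" where
  "setI P R k = best_infeasible P (cache R k) (hmax R k)"

definition dominating_pt ::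
  "('a, 'j) problem \<Rightarrow> 'a ads_run \<Rightarrow> nat \<Rightarrow> 'a \<Rightarrow> 'a \<Rightarrow> 'a \<Rightarrow> bool" where
  "dominating_pt P R k refF refI t \<longleftrightarrow>
     t \<in> feasible P \<and> (setF P R k = {} \<or> dominates P t refF)
   \<or> t \<in> infeasible P \<and> (setI P R k = {} \<or> dominates P t refI)"

abbreviation search_dominating :: "('a, 'j) problem \<Rightarrow> 'a ads_run \<Rightarrow> nat \<Rightarrow> 'a \<Rightarrow> bool" where
  "search_dominating P R k \<equiv> dominating_pt P R k (incF R k) (incI R k)"

definition centerF :: "('a, 'j) problem \<Rightarrow> 'a ads_run \<Rightarrow> nat \<Rightarrow> 'a" where
  "centerF P R k = (case t_search R k of
      Some t \<Rightarrow> if t \<in> feasible P then t else incF R k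
    | None \<Rightarrow> incF R k)"

definition centerI :: "('a, 'j) problem \<Rightarrow> 'a ads_run \<Rightarrow> nat \<Rightarrow> 'a" where
  "centerI P R k = (case t_search R k of
      Some t \<Rightarrow> if t \<notin> feasible P then t else incI R k
    | None \<Rightarrow> incI R k)"

definition centerF_defined :: "('a, 'j) problem \<Rightarrow> 'a ads_run \<Rightarrow> nat \<Rightarrow> bool" where
  "centerF_defined P R k \<longleftrightarrow>
     setF P R k \<noteq> {} \<or> (\<exists>t. t_search R k = Some t \<and> t \<in> feasible P)"

abbreviation poll_dominating :: "('a, 'j) problem \<Rightarrow> 'a ads_run \<Rightarrow> nat \<Rightarrow> 'a \<Rightarrow> bool" where
  "poll_dominating P R k \<equiv> dominating_pt P R k (centerF P R k) (centerI P R k)"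

definition improving_pt :: "('a, 'j) problem \<Rightarrow> 'a ads_run \<Rightarrow> nat \<Rightarrow> 'a \<Rightarrow> bool" where
  "improving_pt P R k t \<longleftrightarrow>
     \<not> search_dominating P R k t \<and>
     setI P R k \<noteq> {} \<and> 0 < viol P t \<and> viol P t < viol P (incI R k)"

definition positive_spanning :: "'a::real_vector set \<Rightarrow> bool" where
  "positive_spanning D \<longleftrightarrow> (\<forall>x. \<exists>a. (\<forall>d\<in>D. 0 \<le> a d) \<and> x = (\<Sum>d\<in>D. a d *\<^sub>R d))"

definition poll_directions :: "'a::real_normed_vector set \<Rightarrow> bool" where
  "poll_directions D \<longleftrightarrow> finite D \<and> (\<forall>v\<in>D. norm v = 1) \<and> positive_spanning D"

definition poll_set :: "('a::real_normed_vector, 'j) problem \<Rightarrow> 'a ads_run \<Rightarrow> nat \<Rightarrow> 'a set" where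
  "poll_set P R k =
    (let PF = (\<lambda>v. centerF P R k + frame R k *\<^sub>R v) ` dirsF R k;
         PI = (\<lambda>v. centerI P R k + frame R k *\<^sub>R v) ` dirsI R k
     in if setI P R k = {} then PF else if setF P R k = {} then PI else PF \<union> PI)"

definition ads_init :: "('a::real_normed_vector, 'j) problem \<Rightarrow> 'a ads_run \<Rightarrow> bool" where
  "ads_init P R \<longleftrightarrow>
     (\<exists>x0\<in>ground P. cache R 0 = {x0} \<and> succ_pts R 0 = {x0}) \<and>
     0 < excl R 0 \<and> excl R 0 \<le> frame R 0 \<and> hmax R 0 = \<infinity>"

definition incumbents :: "('a, 'j) problem \<Rightarrow> 'a ads_run \<Rightarrow> nat \<Rightarrow> bool" where
  "incumbents P R k \<longleftrightarrow>
     (setF P R k \<noteq> {} \<longrightarrow> incF R k \<in> setF P R k) \<and>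
     (setI P R k \<noteq> {} \<longrightarrow> incI R k \<in> setI P R k)"

text \<open>The order of the evaluations is not recorded: an evaluation that may stop at a dominating
  point either exhausts its set or contains a dominating point.\<close>

definition search_step :: "('a::real_normed_vector, 'j) problem \<Rightarrow> 'a ads_run \<Rightarrow> nat \<Rightarrow> bool" where
  "search_step P R k \<longleftrightarrow>
     finite (search_set R k) \<and> search_set R k \<subseteq> ground P \<and>
     search_eval R k \<subseteq> search_set R k \<and>
     (search_eval R k = search_set R k \<or> (\<exists>t\<in>search_eval R k. search_dominating P R k t)) \<and>
     (case t_search R k of
        None \<Rightarrow> \<forall>t\<in>search_eval R k. \<not> search_dominating P R k t
      | Some t \<Rightarrow> t \<in> search_eval R k \<and> search_dominating P R k t \<and>
          (t \<notin> punctured R k \<longrightarrow>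
             (\<forall>s\<in>search_eval R k \<inter> punctured R k. \<not> search_dominating P R k s)))"

definition search_success :: "'a::real_normed_vector ads_run \<Rightarrow> nat \<Rightarrow> bool" where
  "search_success R k \<longleftrightarrow> (\<exists>t. t_search R k = Some t \<and> t \<in> punctured R k)"

text \<open>Poll points outside the ground set have infinite constraint violation and can never be
  dominating; whether they are recorded as evaluated is left open.\<close>

definition poll_step :: "('a::real_normed_vector, 'j) problem \<Rightarrow> 'a ads_run \<Rightarrow> nat \<Rightarrow> bool" where
  "poll_step P R k \<longleftrightarrow>
     poll_directions (dirsF R k) \<and> poll_directions (dirsI R k) \<and>
     (if search_success R k then poll_eval R k = {}
      else poll_eval R k \<subseteq> poll_set P R k \<inter> punctured R k \<and>
           (poll_set P R k \<inter> punctured R k \<inter> ground P \<subseteq> poll_eval R k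
            \<or> (\<exists>t\<in>poll_eval R k. poll_dominating P R k t)))"

definition classify_step :: "('a::real_normed_vector, 'j) problem \<Rightarrow> 'a ads_run \<Rightarrow> nat \<Rightarrow> bool" where
  "classify_step P R k \<longleftrightarrow>
     (if search_success R k then
        outcome_of R k = Dominating \<and> new_succ R k = {the (t_search R k)}
      else if \<exists>t\<in>poll_eval R k \<inter> punctured R k. poll_dominating P R k t then
        outcome_of R k = Dominating \<and>
        (\<exists>t\<in>poll_eval R k \<inter> punctured R k. poll_dominating P R k t \<and> new_succ R k = {t})
      else if t_search R k \<noteq> None then
        outcome_of R k = Reframing \<and> new_succ R k = {}
      else if \<exists>t\<in>cache R (Suc k) \<inter> punctured R k. improving_pt P R k t then
        outcome_of R k = Improving \<and>
        (\<exists>t\<in>cache R (Suc k) \<inter> punctured R k. improving_pt P R k t \<and> new_succ R k = {t})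
      else
        outcome_of R k = Unsuccessful \<and> new_succ R k = {})"

definition threshold_step :: "('a, 'j) problem \<Rightarrow> 'a ads_run \<Rightarrow> nat \<Rightarrow> bool" where
  "threshold_step P R k \<longleftrightarrow>
     (if outcome_of R k = Improving then
        hmax R (Suc k) = Max (viol P ` {x \<in> cache R (Suc k). 0 < viol P x \<and> viol P x < hmax R k})
      else let A = best_infeasible P (cache R (Suc k)) (hmax R k) in
        if A = {} then hmax R (Suc k) = hmax R k else hmax R (Suc k) \<in> viol P ` A)"

definition applies_decrease :: "'a ads_run \<Rightarrow> nat \<Rightarrow> bool" where
  "applies_decrease R k \<longleftrightarrow> outcome_of R k = Reframing \<or> outcome_of R k = Unsuccessful"

definition applies_increase :: "'a ads_run \<Rightarrow> nat \<Rightarrow> bool" where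
  "applies_increase R k \<longleftrightarrow> outcome_of R k = Dominating"

type_synonym update_rule = "real \<times> real \<Rightarrow> real \<times> real"

definition parameter_step :: "update_rule \<Rightarrow> update_rule \<Rightarrow> 'a ads_run \<Rightarrow> nat \<Rightarrow> bool" where
  "parameter_step increase decrease R k \<longleftrightarrow>
     (frame R (Suc k), excl R (Suc k)) =
       (if applies_increase R k then increase (frame R k, excl R k)
        else if applies_decrease R k then decrease (frame R k, excl R k)
        else (frame R k, excl R k))"

definition ads_pb_run ::
  "('a::real_normed_vector, 'j) problem \<Rightarrow> update_rule \<Rightarrow> update_rule \<Rightarrow> 'a ads_run \<Rightarrow> bool" where
  "ads_pb_run P increase decrease R \<longleftrightarrow>
     ads_init P R \<and>
     (\<forall>k. incumbents P R k \<and> search_step P R k \<and> poll_step P R k \<and>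
          cache R (Suc k) = cache R k \<union> search_eval R k \<union> poll_eval R k \<and>
          classify_step P R k \<and>
          succ_pts R (Suc k) = succ_pts R k \<union> new_succ R k \<and>
          threshold_step P R k \<and> parameter_step increase decrease R k)"

definition admissible_rules ::
  "('a::real_normed_vector, 'j) problem \<Rightarrow> update_rule \<Rightarrow> update_rule \<Rightarrow> bool" where
  "admissible_rules P increase decrease \<longleftrightarrow>
     (\<forall>R. ads_pb_run P increase decrease R \<longrightarrow>
        (\<forall>k. 0 < frame R k \<and> 0 < excl R k) \<and>
        (\<forall>k. applies_decrease R k \<longrightarrow> excl R (Suc k) \<le> excl R k) \<and>
        ((\<forall>\<^sub>F k in sequentially. applies_decrease R k) \<longrightarrow> excl R \<longlonglongrightarrow> 0) \<and>
        (\<forall>\<epsilon>>0. \<exists>\<eta>>0. \<forall>k. applies_increase R k \<and> excl R k < \<eta> \<longrightarrow> excl R (Suc k) < \<epsilon>) \<and>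
        (excl R \<longlonglongrightarrow> 0 \<longrightarrow>
           (\<lambda>k. excl R k / frame R k) \<longlonglongrightarrow> 0 \<and> frame R \<longlonglongrightarrow> 0))"


section \<open>Refining subsequences and directions\<close>

abbreviation seq_on :: "nat set \<Rightarrow> nat filter" where
  "seq_on K \<equiv> inf sequentially (principal K)"

definition refining_subseq ::
  "('a::real_normed_vector, 'j) problem \<Rightarrow> 'a ads_run \<Rightarrow> nat set \<Rightarrow> 'a \<Rightarrow> bool" where
  "refining_subseq P R K x \<longleftrightarrow>
     infinite K \<and>
     (\<forall>k\<in>K. outcome_of R k = Unsuccessful \<and> centerF_defined P R k) \<and>
     (centerF P R \<longlongrightarrow> x) (seq_on K) \<and>
     (frame R \<longlongrightarrow> 0) (seq_on K)"

definition refining_direction ::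
  "('a::real_normed_vector, 'j) problem \<Rightarrow> 'a ads_run \<Rightarrow> 'a \<Rightarrow> 'a \<Rightarrow> bool" where
  "refining_direction P R x d \<longleftrightarrow>
     (\<exists>K L v. refining_subseq P R K x \<and> L \<subseteq> K \<and> infinite L \<and>
        (\<forall>k\<in>L. v k \<in> dirsF R k) \<and> (v \<longlongrightarrow> d) (seq_on L) \<and>
        infinite {k \<in> L. centerF P R k + frame R k *\<^sub>R v k \<in> ground P})"


section \<open>Nonsmooth analysis\<close>

definition hypertangent_cone :: "'a::real_normed_vector set \<Rightarrow> 'a \<Rightarrow> 'a set" where
  "hypertangent_cone S x =
     {d. \<exists>\<epsilon>>0. \<forall>p\<in>S \<inter> ball x \<epsilon>. \<forall>v\<in>ball d \<epsilon>. \<forall>t. 0 < t \<and> t < \<epsilon> \<longrightarrow> p + t *\<^sub>R v \<in> S}"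

definition lipschitz_near :: "('a::real_normed_vector \<Rightarrow> ereal) \<Rightarrow> 'a set \<Rightarrow> 'a \<Rightarrow> bool" where
  "lipschitz_near f X x \<longleftrightarrow>
     (\<exists>\<epsilon>>0. \<exists>M. (\<forall>y\<in>X \<inter> ball x \<epsilon>. \<bar>f y\<bar> \<noteq> \<infinity>) \<and>
        M-lipschitz_on (X \<inter> ball x \<epsilon>) (\<lambda>y. real_of_ereal (f y)))"

definition clarke_jahn :: "('a::real_normed_vector \<Rightarrow> ereal) \<Rightarrow> 'a set \<Rightarrow> 'a \<Rightarrow> 'a \<Rightarrow> ereal" where
  "clarke_jahn f S x d =
     Limsup (inf (nhds x \<times>\<^sub>F at_right 0) (principal {(p, t). p \<in> S \<and> p + t *\<^sub>R d \<in> S}))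
       (\<lambda>(p, t). (f (p + t *\<^sub>R d) - f p) / ereal t)"

end

theory Submission
  imports Defs
begin

text \<open>At an unsuccessful iteration the feasible poll center \<open>p\<close> is the best feasible cache point. A poll
  point \<open>p + \<Delta> v\<close> is either evaluated and does not improve on \<open>p\<close>, or lies within \<open>\<delta>\<close> of a cached point
  \<open>z\<close>; then \<open>z = p + \<Delta> v'\<close> with \<open>\<parallel>v' - v\<parallel> < \<delta> / \<Delta>\<close>, so \<open>z\<close> is feasible by hypertangency
  and again \<open>f z \<ge> f p\<close>. By Lipschitz continuity the difference quotient at \<open>p\<close> in the limit direction is
  bounded below by a multiple of \<open>-(\<parallel>v - d\<parallel> + \<delta> / \<Delta>)\<close>. Finally \<open>\<delta> / \<Delta> \<rightarrow> 0\<close> because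
  successful points are \<open>\<delta>\<close>-separated in a compact set, which forces \<open>\<delta> \<rightarrow> 0\<close>.\<close>

section \<open>Compactness and limit superior along a path\<close>

text \<open>If \<open>S\<close> were infinite, its increasing enumeration would give a sequence in
  \<open>L\<close> with a convergent, hence Cauchy, subsequence, whose consecutive terms cannot stay
  \<open>e\<close> apart. Distances are required only for \<open>j < k\<close> since a new point is
  compared with the earlier ones.\<close>

lemma finite_indices_of_separated:
  fixes y :: "nat \<Rightarrow> 'a::metric_space"
  assumes "compact L" "0 < e"
    and "\<And>k. k \<in> S \<Longrightarrow> y k \<in> L"
    and "\<And>j k. j \<in> S \<Longrightarrow> k \<in> S \<Longrightarrow> j < k \<Longrightarrow> e \<le> dist (y k) (y j)"
  shows "finite S"
proof (rule ccontr)
  assume inf: "infinite S"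
  define z where "z = y \<circ> enumerate S"
  have "\<forall>n. z n \<in> L"
    using assms(3) enumerate_in_set[OF inf] by (simp add: z_def)
  then obtain l r where r: "strict_mono r" "(z \<circ> r) \<longlonglongrightarrow> l"
    using \<open>compact L\<close> unfolding compact_def by blast
  then have "Cauchy (z \<circ> r)"
    by (simp add: LIMSEQ_imp_Cauchy)
  then obtain N where N: "\<And>m n. m \<ge> N \<Longrightarrow> n \<ge> N \<Longrightarrow> dist ((z \<circ> r) m) ((z \<circ> r) n) < e"
    using \<open>0 < e\<close> unfolding Cauchy_def by blast
  have "enumerate S (r N) < enumerate S (r (Suc N))"
    using enumerate_mono[OF _ inf] r(1) by (simp add: strict_mono_def)
  then have "e \<le> dist ((z \<circ> r) (Suc N)) ((z \<circ> r) N)"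
    using assms(4) enumerate_in_set[OF inf] by (simp add: z_def)
  then show False
    using N[of "Suc N" N] by simp
qed

lemma seq_on_neq_bot: "infinite K \<Longrightarrow> seq_on K \<noteq> bot"
  by (auto simp: trivial_limit_def eventually_inf_principal eventually_sequentially
      infinite_nat_iff_unbounded_le)

text \<open>A negative limit superior leaves room for some \<open>c < 0\<close> with
  \<open>g < c\<close> eventually on \<open>F\<close>, hence along the path \<open>q\<close>; but
  there the lower bounds \<open>- e k\<close> rise above \<open>c\<close>. So one path into
  \<open>F\<close> suffices.\<close>

lemma Limsup_nonneg_along:
  fixes g :: "'b \<Rightarrow> ereal" and e :: "'c \<Rightarrow> real"
  assumes "filterlim q F G" "G \<noteq> bot" "(e \<longlongrightarrow> 0) G"
    and "\<forall>\<^sub>F k in G. ereal (- e k) \<le> g (q k)"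
  shows "0 \<le> Limsup F g"
proof (rule ccontr)
  assume "\<not> 0 \<le> Limsup F g"
  then obtain c where c: "Limsup F g < c" "c < 0"
    using dense[of "Limsup F g" 0] by (auto simp: not_le)
  have "\<forall>\<^sub>F k in G. g (q k) < c"
    using eventually_compose_filterlim[OF Limsup_lessD[OF c(1)] assms(1)] .
  moreover have "((\<lambda>k. ereal (- e k)) \<longlongrightarrow> 0) G"
    using tendsto_minus[OF assms(3)] by (simp add: zero_ereal_def)
  then have "\<forall>\<^sub>F k in G. c < ereal (- e k)"
    using c(2) by (rule order_tendstoD(1))
  ultimately have "\<forall>\<^sub>F k in G. False"
    using assms(4) by eventually_elim auto
  then show False
    using assms(2) by (simp add: trivial_limit_def)
qed

section \<open>Bookkeeping of stored successful points\<close>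

locale ads_pb =
  fixes P :: "('a::real_normed_vector, 'j) problem"
    and increase decrease :: update_rule
    and R :: "'a ads_run"
  assumes finite_indices: "finite (indices P)"
    and run: "ads_pb_run P increase decrease R"
    and rules: "admissible_rules P increase decrease"
begin

lemma steps:
  shows "incumbents P R k" "search_step P R k" "poll_step P R k" "classify_step P R k"
    and "cache R (Suc k) = cache R k \<union> search_eval R k \<union> poll_eval R k"
    and "succ_pts R (Suc k) = succ_pts R k \<union> new_succ R k"
    and "parameter_step increase decrease R k"
  using run by (auto simp: ads_pb_run_def)

lemma frame_pos: "0 < frame R k" and excl_pos: "0 < excl R k"
  and excl_decrease: "applies_decrease R k \<Longrightarrow> excl R (Suc k) \<le> excl R k"
  and excl_tendsto_0_if_decreasing:
    "\<forall>\<^sub>F k in sequentially. applies_decrease R k \<Longrightarrow> excl R \<longlonglongrightarrow> 0"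
  and excl_increase:
    "0 < e \<Longrightarrow> \<exists>d>0. \<forall>k. applies_increase R k \<and> excl R k < d \<longrightarrow> excl R (Suc k) < e"
  and ratio_tendsto_0: "excl R \<longlonglongrightarrow> 0 \<Longrightarrow> (\<lambda>k. excl R k / frame R k) \<longlonglongrightarrow> 0"
  using rules run unfolding admissible_rules_def by blast+

lemma dominating_pt_in_ground: "dominating_pt P R k x y t \<Longrightarrow> t \<in> ground P"
  by (auto simp: dominating_pt_def feasible_def infeasible_def)

text \<open>Outside the ground set the violation is \<open>\<infinity>\<close>, which is never
  strictly below that of the incumbent.\<close>

lemma improving_pt_in_ground: "improving_pt P R k t \<Longrightarrow> t \<in> ground P"
  by (auto simp: improving_pt_def viol_def split: if_splits)

text \<open>Dominating and improving iterations store exactly one point, reframing and unsuccessful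
  ones none. Membership in \<open>ground P\<close> is recorded because compactness is assumed only
  for cached points of the ground set.\<close>

lemma new_succ_cases:
  obtains "applies_decrease R k" "new_succ R k = {}"
  | t where "\<not> applies_decrease R k" "new_succ R k = {t}"
      "t \<in> cache R (Suc k)" "t \<in> punctured R k" "t \<in> ground P"
proof (cases "search_success R k")
  case True
  then obtain t where t: "t_search R k = Some t" "t \<in> punctured R k"
    by (auto simp: search_success_def)
  then have "t \<in> search_eval R k" "search_dominating P R k t"
    using steps(2)[of k] by (auto simp: search_step_def)
  then show ?thesis
    using that(2)[of t] True t steps(4,5)[of k] dominating_pt_in_ground
    by (auto simp: classify_step_def applies_decrease_def)
next
  case False
  then show ?thesis
    using that steps(4,5)[of k] dominating_pt_in_ground improving_pt_in_ground
    by (auto simp: classify_step_def applies_decrease_def split: if_splits)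
qed

text \<open>Ensures that a stored point blocking a poll point is among the cached points over which
  the feasible incumbent is minimal.\<close>

lemma succ_pts_subset_cache: "succ_pts R k \<subseteq> cache R k"
proof (induction k)
  case 0
  then show ?case
    using run by (auto simp: ads_pb_run_def ads_init_def)
next
  case (Suc k)
  then show ?case
    by (rule_tac k = k in new_succ_cases) (auto simp: steps(5,6))
qed

lemma succ_pts_mono: "j \<le> k \<Longrightarrow> succ_pts R j \<subseteq> succ_pts R k"
  by (rule lift_Suc_mono_le[where f = "succ_pts R"]) (auto simp: steps(6))

section \<open>Convergence of the exclusion size to zero\<close>

text \<open>Each newly stored point lies in the punctured space, so it is at least
  \<open>excl R k\<close>, hence \<open>e\<close>, away from all points stored earlier.\<close>

lemma finite_large_excl_successes:
  assumes "compact L" "\<And>k. cache R k \<inter> ground P \<subseteq> L" "0 < e"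
  shows "finite {k. \<not> applies_decrease R k \<and> e \<le> excl R k}"
proof (rule finite_indices_of_separated[OF assms(1,3)])
  fix k assume "k \<in> {k. \<not> applies_decrease R k \<and> e \<le> excl R k}"
  then show "the_elem (new_succ R k) \<in> L"
    using assms(2)[of "Suc k"] by (cases k rule: new_succ_cases) auto
next
  fix j k
  assume j: "j \<in> {k. \<not> applies_decrease R k \<and> e \<le> excl R k}"
    and k: "k \<in> {k. \<not> applies_decrease R k \<and> e \<le> excl R k}" and "j < k"
  obtain s where s: "new_succ R j = {s}"
    using j by (cases j rule: new_succ_cases) auto
  then have "s \<in> succ_pts R k"
    using succ_pts_mono[of "Suc j" k] \<open>j < k\<close> by (auto simp: steps(6))
  moreover obtain t where t: "new_succ R k = {t}" "t \<in> punctured R k"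
    using k by (cases k rule: new_succ_cases) auto
  ultimately show "e \<le> dist (the_elem (new_succ R k)) (the_elem (new_succ R j))"
    using s k by (force simp: punctured_def dist_norm)
qed

text \<open>Either almost all iterations decrease and the update rule gives the limit, or
  non-decreasing iterations recur. Late ones start from a small exclusion size and leave it below
  \<open>e\<close>; decreases in between preserve this bound.\<close>

lemma excl_tendsto_0:
  assumes "compact L" "\<And>k. cache R k \<inter> ground P \<subseteq> L"
  shows "excl R \<longlonglongrightarrow> 0"
proof (cases "\<forall>\<^sub>F k in sequentially. applies_decrease R k")
  case True
  then show ?thesis by (rule excl_tendsto_0_if_decreasing)
next
  case False
  show ?thesis
  proof (rule order_tendstoI)
    fix a :: real assume "a < 0"
    then show "\<forall>\<^sub>F k in sequentially. a < excl R k"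
      using excl_pos by (auto intro: always_eventually less_trans)
  next
    fix e :: real assume "0 < e"
    then obtain d where "0 < d"
      and d: "\<And>k. applies_increase R k \<Longrightarrow> excl R k < d \<Longrightarrow> excl R (Suc k) < e"
      using excl_increase by metis
    \<comment> \<open>In the minimum, \<open>d\<close> serves the iterations that apply
      \<open>increase\<close>, and \<open>e\<close> the improving ones, which leave the exclusion
      size unchanged.\<close>
    have "finite {k. \<not> applies_decrease R k \<and> min d e \<le> excl R k}"
      using finite_large_excl_successes[OF assms] \<open>0 < d\<close> \<open>0 < e\<close> by simp
    then obtain N where N: "\<And>k. k \<ge> N \<Longrightarrow> \<not> applies_decrease R k \<Longrightarrow> excl R k < min d e"
      unfolding finite_nat_set_iff_bounded by (metis (mono_tags) linorder_not_le mem_Collect_eq)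
    have succ: "excl R (Suc k) < e" if "k \<ge> N" "\<not> applies_decrease R k" for k
    proof (cases "applies_increase R k")
      case True
      then show ?thesis using d N[OF that] by simp
    next
      case False
      then have "excl R (Suc k) = excl R k"
        using steps(7)[of k] that(2) by (simp add: parameter_step_def)
      then show ?thesis using N[OF that] by simp
    qed
    \<comment> \<open>A non-decreasing iteration beyond \<open>N\<close> anchors the induction: the
      bound first holds at \<open>Suc m\<close>.\<close>
    obtain m where m: "m \<ge> N" "\<not> applies_decrease R m"
      using False by (auto simp: eventually_sequentially)
    have "excl R k < e" if "k \<ge> Suc m" for k
      using that
    proof (induction k rule: dec_induct)
      case base
      then show ?case using succ m by simp
    next
      case (step k)
      then show ?case
        using succ[of k] excl_decrease[of k] m(1) by fastforce
    qed
    then show "\<forall>\<^sub>F k in sequentially. excl R k < e"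
      by (auto simp: eventually_sequentially)
  qed
qed

section \<open>Polling at unsuccessful iterations\<close>

lemma feasible_iff: "x \<in> feasible P \<longleftrightarrow> viol P x = 0"
  using feasible_iff_viol_eq_0[OF finite_indices] by (auto simp: viol_def)

text \<open>A dominating search point would make the iteration dominating or reframing. Hence
  \<open>t_search\<close> is \<open>None\<close> and the center is the feasible incumbent.\<close>

lemma unsuccessful_centerF:
  assumes "outcome_of R k = Unsuccessful" "centerF_defined P R k"
  shows "setF P R k \<noteq> {}" "centerF P R k \<in> feasible P"
    and "\<And>z. z \<in> cache R k \<Longrightarrow> z \<in> feasible P \<Longrightarrow>
      objective P (centerF P R k) \<le> objective P z"
proof -
  have none: "t_search R k = None"
    using assms(1) steps(4)[of k] by (auto simp: classify_step_def split: if_splits)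
  then show ne: "setF P R k \<noteq> {}"
    using assms(2) by (simp add: centerF_defined_def)
  have "centerF P R k \<in> best_feasible P (cache R k)"
    using none ne steps(1)[of k] by (simp add: centerF_def incumbents_def setF_def)
  then show "centerF P R k \<in> feasible P"
    and "\<And>z. z \<in> cache R k \<Longrightarrow> z \<in> feasible P \<Longrightarrow>
      objective P (centerF P R k) \<le> objective P z"
    by (auto simp: best_feasible_def is_arg_min_linorder feasible_iff)
qed

text \<open>Separates the algorithm from the analysis: hypertangency enters only through
  \<open>ht\<close>. The witness is \<open>v\<close> itself if the poll point was evaluated, and
  otherwise the rescaled direction to the stored point that excludes it.\<close>

lemma unsuccessful_witness:
  assumes uns: "outcome_of R k = Unsuccessful" "centerF_defined P R k"
    and v: "v \<in> dirsF R k"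
    and ht: "\<And>w. norm (w - v) \<le> excl R k / frame R k \<Longrightarrow>
      centerF P R k + frame R k *\<^sub>R w \<in> feasible P"
  obtains w where "norm (w - v) \<le> excl R k / frame R k"
    and "centerF P R k + frame R k *\<^sub>R w \<in> feasible P"
    and "objective P (centerF P R k) \<le> objective P (centerF P R k + frame R k *\<^sub>R w)"
proof -
  let ?p = "centerF P R k" and ?D = "frame R k"
  let ?t = "?p + ?D *\<^sub>R v"
  note ctr = unsuccessful_centerF[OF uns]
  have t: "?t \<in> feasible P"
    using ht[of v] frame_pos[of k] excl_pos[of k] by simp
  show thesis
  proof (cases "?t \<in> punctured R k")
    case True
    have no: "\<not> search_success R k" "\<And>s. s \<in> poll_eval R k \<inter> punctured R k \<Longrightarrow> \<not> poll_dominating P R k s"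
      using uns(1) steps(4)[of k] by (auto simp: classify_step_def split: if_splits)
    have "?t \<in> poll_set P R k"
      using v ctr(1) by (auto simp: poll_set_def Let_def)
    \<comment> \<open>The poll may stop early only at a dominating point, which \<open>no\<close>
      excludes, so every poll point in the punctured space and the ground set was evaluated.\<close>
    then have "?t \<in> poll_eval R k"
      using no True t steps(3)[of k] by (auto simp: poll_step_def feasible_def)
    then have "\<not> dominates P ?t ?p"
      using no(2)[of ?t] True t by (auto simp: dominating_pt_def)
    then have "objective P ?p \<le> objective P ?t"
      using t ctr(2) by (auto simp: dominates_def)
    then show thesis
      using that[of v] t frame_pos[of k] excl_pos[of k] by simp
  next
    case False
    then obtain y where y: "y \<in> succ_pts R k" "norm (?t - y) < excl R k"
      by (auto simp: punctured_def not_le)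
    define w where "w = (y - ?p) /\<^sub>R ?D"
    have yw: "y = ?p + ?D *\<^sub>R w"
      using frame_pos[of k] by (simp add: w_def)
    have "?D * norm (w - v) = norm (?D *\<^sub>R (w - v))"
      using frame_pos[of k] by simp
    also have "\<dots> = norm (?t - y)"
      by (subst norm_minus_commute) (simp add: yw algebra_simps)
    finally have "norm (w - v) \<le> excl R k / ?D"
      using y(2) frame_pos[of k] by (simp add: field_simps)
    then show thesis
      using that[of w] ht[of w] ctr(3)[of y] y(1) succ_pts_subset_cache[of k] yw by auto
  qed
qed

section \<open>The Clarke-Jahn derivative in a refining direction\<close>

theorem clarke_jahn_refining_nonneg:
  assumes "compact L" "\<And>k. cache R k \<inter> ground P \<subseteq> L"
    and lip: "lipschitz_near (objective P) (ground P) x"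
    and ht: "d \<in> hypertangent_cone (feasible P) x"
    and ref: "refining_direction P R x d"
  shows "0 \<le> clarke_jahn (objective P) (feasible P) x d"
proof -
  let ?f = "objective P" and ?p = "centerF P R" and ?D = "frame R"
  let ?\<rho> = "\<lambda>k. excl R k / frame R k"
  obtain K S v where K: "refining_subseq P R K x" "S \<subseteq> K" "infinite S"
    and v: "\<And>k. k \<in> S \<Longrightarrow> v k \<in> dirsF R k" and vlim: "(v \<longlongrightarrow> d) (seq_on S)"
    using ref unfolding refining_direction_def by blast
  have uns: "outcome_of R k = Unsuccessful" "centerF_defined P R k" if "k \<in> S" for k
    using that K(1,2) by (auto simp: refining_subseq_def)
  have sub: "seq_on S \<le> seq_on K"
    using K(2) by (simp add: inf.coboundedI2)
  have plim: "(?p \<longlongrightarrow> x) (seq_on S)" and Dlim: "(?D \<longlongrightarrow> 0) (seq_on S)"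
    using K(1) tendsto_mono[OF sub] by (auto simp: refining_subseq_def)
  have rlim: "(?\<rho> \<longlongrightarrow> 0) (seq_on S)"
    using ratio_tendsto_0[OF excl_tendsto_0[OF assms(1,2)]] by (rule tendsto_mono[rotated]) simp
  have inS: "\<forall>\<^sub>F k in seq_on S. k \<in> S"
    by (simp add: eventually_inf_principal)
  obtain a where "0 < a" and a: "\<And>p w t. p \<in> feasible P \<Longrightarrow> dist x p < a \<Longrightarrow> dist d w < a \<Longrightarrow>
      0 < t \<Longrightarrow> t < a \<Longrightarrow> p + t *\<^sub>R w \<in> feasible P"
    using ht unfolding hypertangent_cone_def by fastforce
  obtain b M where "0 < b" and fin: "\<And>y. y \<in> ground P \<inter> ball x b \<Longrightarrow> \<bar>?f y\<bar> \<noteq> \<infinity>"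
    and M: "M-lipschitz_on (ground P \<inter> ball x b) (\<lambda>y. real_of_ereal (?f y))"
    using lip unfolding lipschitz_near_def by (elim exE conjE) auto
  \<comment> \<open>\<open>e k\<close> bounds, per unit of frame size, the Lipschitz cost of
    replacing the witness direction by \<open>d\<close>; \<open>s k\<close> bounds the distance from
    \<open>x\<close> of the trial points considered, keeping them in the Lipschitz ball.\<close>
  define e where "e k = M * (norm (v k - d) + ?\<rho> k)" for k
  define s where "s k = norm (?p k - x) + ?D k * (norm d + norm (v k - d) + ?\<rho> k)" for k
  have vd: "((\<lambda>k. norm (v k - d)) \<longlongrightarrow> 0) (seq_on S)"
    using vlim by (simp add: LIM_zero tendsto_norm_zero)
  have pd: "((\<lambda>k. norm (?p k - x)) \<longlongrightarrow> 0) (seq_on S)"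
    using plim by (simp add: LIM_zero tendsto_norm_zero)
  have sumlim: "((\<lambda>k. norm (v k - d) + ?\<rho> k) \<longlongrightarrow> 0) (seq_on S)"
    using tendsto_add_zero[OF vd rlim] .
  have elim: "(e \<longlongrightarrow> 0) (seq_on S)"
    unfolding e_def using tendsto_mult_right_zero[OF sumlim] .
  have slim: "(s \<longlongrightarrow> 0) (seq_on S)"
    using tendsto_add[OF pd tendsto_mult[OF Dlim tendsto_add[OF tendsto_const[of "norm d"] sumlim]]]
    by (simp add: s_def[abs_def] add.assoc)
  have small: "\<forall>\<^sub>F k in seq_on S. k \<in> S \<and> norm (?p k - x) < a \<and> ?D k < a \<and>
      norm (v k - d) + ?\<rho> k < a \<and> s k < b"
    using inS order_tendstoD(2)[OF pd \<open>0 < a\<close>] order_tendstoD(2)[OF Dlim \<open>0 < a\<close>]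
      order_tendstoD(2)[OF sumlim \<open>0 < a\<close>] order_tendstoD(2)[OF slim \<open>0 < b\<close>]
    by eventually_elim auto
  have key: "?p k \<in> feasible P \<and> ?p k + ?D k *\<^sub>R d \<in> feasible P \<and>
      ereal (- e k) \<le> (?f (?p k + ?D k *\<^sub>R d) - ?f (?p k)) / ereal (?D k)"
    if k: "k \<in> S \<and> norm (?p k - x) < a \<and> ?D k < a \<and>
      norm (v k - d) + ?\<rho> k < a \<and> s k < b" for k
  proof -
    have p: "?p k \<in> feasible P"
      using unsuccessful_centerF(2)[OF uns] k by blast
    have \<rho>: "0 \<le> ?\<rho> k"
      using frame_pos[of k] excl_pos[of k] by simp
    \<comment> \<open>One radius around \<open>d\<close> covers both \<open>d\<close> and the
      witness, so feasibility and nearness to \<open>x\<close> are proved once for both.\<close>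
    have close: "norm (w - d) \<le> norm (v k - d) + ?\<rho> k" if "norm (w - v k) \<le> ?\<rho> k" for w
      using that norm_triangle_ineq[of "w - v k" "v k - d"] by simp
    have feas: "?p k + ?D k *\<^sub>R w \<in> feasible P"
      if "norm (w - d) \<le> norm (v k - d) + ?\<rho> k" for w
      using a[OF p, of w "?D k"] that k frame_pos[of k]
      by (auto simp: dist_norm norm_minus_commute)
    have near: "?p k + ?D k *\<^sub>R w \<in> ground P \<inter> ball x b"
      if "norm (w - d) \<le> norm (v k - d) + ?\<rho> k" for w
    proof -
      have "norm w \<le> norm d + norm (v k - d) + ?\<rho> k"
        using that norm_triangle_ineq[of d "w - d"] by simp
      then have "?D k * norm w \<le> ?D k * (norm d + norm (v k - d) + ?\<rho> k)"
        using frame_pos[of k] by (intro mult_left_mono) auto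
      moreover have "norm (?p k + ?D k *\<^sub>R w - x) \<le> norm (?p k - x) + ?D k * norm w"
        using norm_triangle_ineq[of "?p k - x" "?D k *\<^sub>R w"] frame_pos[of k]
        by (simp add: algebra_simps)
      ultimately have "norm (?p k + ?D k *\<^sub>R w - x) < b"
        using k by (simp add: s_def)
      then show ?thesis
        using feas[OF that] by (simp add: feasible_def dist_norm norm_minus_commute)
    qed
    obtain w where w: "norm (w - v k) \<le> ?\<rho> k"
      and dec: "?f (?p k) \<le> ?f (?p k + ?D k *\<^sub>R w)"
      using unsuccessful_witness[OF uns v, of k] feas close k by metis
    have "norm (?p k - x) \<le> s k"
      using frame_pos[of k] \<rho> by (simp add: s_def)
    then have "?p k \<in> ground P \<inter> ball x b"
      using p k by (simp add: feasible_def dist_norm norm_minus_commute)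
    then have "\<bar>?f (?p k)\<bar> \<noteq> \<infinity>" by (rule fin)
    then obtain r0 where r0: "?f (?p k) = ereal r0"
      by auto
    have nd: "?p k + ?D k *\<^sub>R d \<in> ground P \<inter> ball x b"
      using near[of d] \<rho> by simp
    then obtain r1 where r1: "?f (?p k + ?D k *\<^sub>R d) = ereal r1"
      using fin by fastforce
    have nw: "?p k + ?D k *\<^sub>R w \<in> ground P \<inter> ball x b"
      using near close w by blast
    then obtain r2 where r2: "?f (?p k + ?D k *\<^sub>R w) = ereal r2"
      using fin by fastforce
    \<comment> \<open>The witness value \<open>r2\<close> links the other two: \<open>dec\<close>
      gives \<open>r0 \<le> r2\<close>, and the Lipschitz bound on \<open>r2 - r1\<close> passes
      this to the fixed direction \<open>d\<close>.\<close>
    have "r2 - r1 \<le> M * norm (?D k *\<^sub>R (w - d))"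
      using lipschitz_onD[OF M nw nd] r1 r2 by (simp add: dist_norm algebra_simps)
    also have "\<dots> \<le> ?D k * e k"
      using mult_left_mono[OF close[OF w], of "?D k * M"] frame_pos[of k] lipschitz_on_nonneg[OF M]
      by (simp add: e_def mult_ac)
    finally have "- e k \<le> (r1 - r0) / ?D k"
      using dec r0 r2 frame_pos[of k] by (simp add: field_simps)
    then show ?thesis
      using p feas[of d] \<rho> r0 r1 frame_pos[of k] by simp
  qed
  \<comment> \<open>Centers and frame sizes form an admissible path for the limit superior: frame
    sizes are positive, and \<open>key\<close> makes both endpoints feasible.\<close>
  have "filterlim (\<lambda>k. (?p k, ?D k))
      (inf (nhds x \<times>\<^sub>F at_right 0)
        (principal {(p, t). p \<in> feasible P \<and> p + t *\<^sub>R d \<in> feasible P})) (seq_on S)"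
    unfolding filterlim_inf filterlim_principal
  proof
    show "filterlim (\<lambda>k. (?p k, ?D k)) (nhds x \<times>\<^sub>F at_right 0) (seq_on S)"
      using plim Dlim frame_pos by (intro filterlim_Pair) (auto simp: filterlim_at less_imp_neq[THEN not_sym])
    show "\<forall>\<^sub>F k in seq_on S. (?p k, ?D k) \<in>
        {(p, t). p \<in> feasible P \<and> p + t *\<^sub>R d \<in> feasible P}"
      using small by eventually_elim (use key in auto)
  qed
  then show ?thesis
    unfolding clarke_jahn_def
  proof (rule Limsup_nonneg_along[OF _ seq_on_neq_bot[OF K(3)] elim])
    show "\<forall>\<^sub>F k in seq_on S. ereal (- e k) \<le>
        (case (?p k, ?D k) of (p, t) \<Rightarrow> (?f (p + t *\<^sub>R d) - ?f p) / ereal t)"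
      using small by eventually_elim (use key in auto)
  qed
qed

end

theorem theorem3p2:
  fixes P :: "(real ^ 'n, 'j) problem"
    and R :: "(real ^ 'n) ads_run"
    and increase decrease :: update_rule
    and L :: "(real ^ 'n) set" and K :: "nat set" and xF :: "real ^ 'n"
  assumes "finite (indices P)"
    and "admissible_rules P increase decrease"
    and "ads_pb_run P increase decrease R"
    and "compact L" and "\<And>k. cache R k \<inter> ground P \<subseteq> L"
    and "refining_subseq P R K xF"
    and "xF \<in> feasible P"
    and "lipschitz_near (objective P) (ground P) xF"
  shows "\<forall>d. d \<in> hypertangent_cone (feasible P) xF \<and> refining_direction P R xF d
           \<longrightarrow> clarke_jahn (objective P) (feasible P) xF d \<ge> 0"
proof -
  interpret ads_pb P increase decrease R
    using assms(1-3) by unfold_locales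
  show ?thesis
    using clarke_jahn_refining_nonneg[OF assms(4,5,8)] by blast
qed

end
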